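(* Let $G$ be a countable residually finite group, equipped with a proper right-invariant metric. Let $\sigma$ be a semi-conjugacy-separating family of finite-index subgroups of $G$. Then $\operatorname{asdim}(G)\le\operatorname{asdim}(\square_\sigma G)$.
   Context: A coarse space is a set $X$ with a collection $\mathcal E$ of subsets of $X\times X$ (entourages) that contains the diagonal and is closed under subsets, finite unions, inverses and compositions. It is connected if $\{(x,y)\}\in\mathcal E$ for all $x,y\in X$. A coarse space $(X,\mathcal E)$ has $\operatorname{asdim}(X)\le n$ if for every $E\in\mathcal E$ there is a cover $\mathcal U$ of $X$ such that $\bigcup_{U\in\mathcal U}U\times U\in\mathcal E$, any $n+2$ distinct members of $\mathcal U$ have empty intersection, and every non-empty $A\subseteq X$ with $A\times A\subseteq E$ is contained in some $U\in\mathcal U$. (For a metric space with entourages the subsets of the sets $\{d\le R\}$: for each $R>0$ there is a uniformly bounded cover of multiplicity at most $n+1$ and Lebesgue number at least $R$.) $\operatorname{asdim}(X)\in\{0,1,2,\dots\}\cup\{\infty\}$ is the least such $n$, or $\infty$ if there is none. A metric on $G$ is proper if its balls are finite; $\operatorname{asdim}(G)$ is that of $G$ with the given metric. Let $\sigma=(G_\alpha)_\alpha$ be a family (repetitions allowed) of finite-index, not necessarily normal, subgroups of $G$. The box space $\square_\sigma G$ is the set $\bigsqcup_\alpha G/G_\alpha$ (left cosets, with $G$ acting by left multiplication) equipped with the smallest connected $G$-invariant coarse structure containing the sets $\Delta_g=\{(x,gx) : x\in\bigsqcup_\alpha G/G_\alpha\}$ for all $g\in G$. The family $\sigma$ is semi-conjugacy-separating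 if for every non-empty finite $F\subset G$ there is $G_\alpha\in\sigma$ with $G_\alpha\cap g^G G_\alpha=\varnothing$ for every $g\in F\setminus\{1\}$, where $g^G$ is the conjugacy class of $g$. *)

theory Defs
  imports
    "HOL-Algebra.Left_Coset"
    "HOL-Analysis.Abstract_Metric_Spaces"
    "HOL-Library.Extended_Nat"
    "HOL-Library.Countable_Set"
begin

locale coarse_space =
  fixes X :: "'x set" and \<E> :: "('x \<times> 'x) set set"
  assumes entourage_subset: "E \<in> \<E> \<Longrightarrow> E \<subseteq> X \<times> X"
    and diagonal: "Id_on X \<in> \<E>"
    and subset_closed: "\<lbrakk>E \<in> \<E>; E' \<subseteq> E\<rbrakk> \<Longrightarrow> E' \<in> \<E>"
    and Un_closed: "\<lbrakk>E \<in> \<E>; E' \<in> \<E>\<rbrakk> \<Longrightarrow> E \<union> E' \<in> \<E>"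
    and converse_closed: "E \<in> \<E> \<Longrightarrow> E\<inverse> \<in> \<E>"
    and relcomp_closed: "\<lbrakk>E \<in> \<E>; E' \<in> \<E>\<rbrakk> \<Longrightarrow> E O E' \<in> \<E>"

definition connected_coarse :: "'x set \<Rightarrow> ('x \<times> 'x) set set \<Rightarrow> bool" where
  "connected_coarse X \<E> \<longleftrightarrow> (\<forall>x\<in>X. \<forall>y\<in>X. {(x, y)} \<in> \<E>)"

definition asdim_le :: "'x set \<Rightarrow> ('x \<times> 'x) set set \<Rightarrow> nat \<Rightarrow> bool" where
  "asdim_le X \<E> n \<longleftrightarrow>
    (\<forall>E\<in>\<E>. \<exists>\<U>. \<U> \<subseteq> Pow X \<and> \<Union>\<U> = X
      \<and> (\<Union>U\<in>\<U>. U \<times> U) \<in> \<E>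
      \<and> (\<forall>\<V>\<subseteq>\<U>. card \<V> = n + 2 \<longrightarrow> \<Inter>\<V> = {})
      \<and> (\<forall>A\<subseteq>X. A \<noteq> {} \<and> A \<times> A \<subseteq> E \<longrightarrow> (\<exists>U\<in>\<U>. A \<subseteq> U)))"

text \<open>In \<^typ>\<open>enat\<close> the infimum of the empty set is \<open>\<infinity>\<close>.\<close>

definition asdim :: "'x set \<Rightarrow> ('x \<times> 'x) set set \<Rightarrow> enat" where
  "asdim X \<E> = (INF n\<in>{n. asdim_le X \<E> n}. enat n)"

definition metric_coarse :: "'x set \<Rightarrow> ('x \<Rightarrow> 'x \<Rightarrow> real) \<Rightarrow> ('x \<times> 'x) set set" where
  "metric_coarse X d = {E. \<exists>R. E \<subseteq> {(x, y). x \<in> X \<and> y \<in> X \<and> d x y \<le> R}}"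

lemma (in Metric_space) coarse_space_metric_coarse: "coarse_space M (metric_coarse M d)"
proof
  show "Id_on M \<in> metric_coarse M d"
    by (force simp: metric_coarse_def)
next
  fix E E' assume "E \<in> metric_coarse M d" "E' \<in> metric_coarse M d"
  then obtain R R' where R: "\<And>x y. (x, y) \<in> E \<Longrightarrow> x \<in> M \<and> y \<in> M \<and> d x y \<le> R"
    and R': "\<And>x y. (x, y) \<in> E' \<Longrightarrow> x \<in> M \<and> y \<in> M \<and> d x y \<le> R'"
    unfolding metric_coarse_def by blast
  have "E \<union> E' \<subseteq> {(x, y). x \<in> M \<and> y \<in> M \<and> d x y \<le> max R R'}"
    using R R' by fastforce
  then show "E \<union> E' \<in> metric_coarse M d"
    unfolding metric_coarse_def by blast
  have "E O E' \<subseteq> {(x, y). x \<in> M \<and> y \<in> M \<and> d x y \<le> R + R'}"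
  proof clarify
    fix x y z assume "(x, y) \<in> E" "(y, z) \<in> E'"
    then show "x \<in> M \<and> z \<in> M \<and> d x z \<le> R + R'"
      using R[of x y] R'[of y z] triangle[of x y z] by linarith
  qed
  then show "E O E' \<in> metric_coarse M d"
    unfolding metric_coarse_def by blast
next
  fix E assume "E \<in> metric_coarse M d"
  then obtain R where R: "\<And>x y. (x, y) \<in> E \<Longrightarrow> x \<in> M \<and> y \<in> M \<and> d x y \<le> R"
    unfolding metric_coarse_def by blast
  have "E\<inverse> \<subseteq> {(x, y). x \<in> M \<and> y \<in> M \<and> d x y \<le> R}"
  proof clarify
    fix x y assume "(x, y) \<in> E"
    then show "y \<in> M \<and> x \<in> M \<and> d y x \<le> R"
      using R[of x y] commute[of y x] by simp
  qed
  then show "E\<inverse> \<in> metric_coarse M d"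
    unfolding metric_coarse_def by blast
next
  fix E E' assume "E \<in> metric_coarse M d" "E' \<subseteq> E"
  then show "E' \<in> metric_coarse M d"
    unfolding metric_coarse_def by blast
next
  fix E assume "E \<in> metric_coarse M d"
  then show "E \<subseteq> M \<times> M"
    unfolding metric_coarse_def by blast
qed

definition residually_finite :: "('a, 'b) monoid_scheme \<Rightarrow> bool" where
  "residually_finite G \<longleftrightarrow>
    (\<forall>g\<in>carrier G - {\<one>\<^bsub>G\<^esub>}. \<exists>N. N \<lhd> G \<and> finite (lcosets\<^bsub>G\<^esub> N) \<and> g \<notin> N)"

definition proper_metric :: "'x set \<Rightarrow> ('x \<Rightarrow> 'x \<Rightarrow> real) \<Rightarrow> bool" where
  "proper_metric X d \<longleftrightarrow>
    Metric_space X d \<and> (\<forall>x\<in>X. \<forall>r. finite (Metric_space.mcball X d x r))"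

definition right_invariant :: "('a, 'b) monoid_scheme \<Rightarrow> ('a \<Rightarrow> 'a \<Rightarrow> real) \<Rightarrow> bool" where
  "right_invariant G d \<longleftrightarrow>
    (\<forall>x\<in>carrier G. \<forall>y\<in>carrier G. \<forall>g\<in>carrier G. d (x \<otimes>\<^bsub>G\<^esub> g) (y \<otimes>\<^bsub>G\<^esub> g) = d x y)"

definition finite_index_subgroup :: "'a set \<Rightarrow> ('a, 'b) monoid_scheme \<Rightarrow> bool" where
  "finite_index_subgroup K G \<longleftrightarrow> subgroup K G \<and> finite (lcosets\<^bsub>G\<^esub> K)"

text \<open>
  A family of subgroups is an index set \<open>I\<close> together with a map \<open>H\<close> on indices.
  Tagging cosets with their index makes the union disjoint even if subgroups are repeated.
\<close>

definition box_space :: "('a, 'b) monoid_scheme \<Rightarrow> 'i set \<Rightarrow> ('i \<Rightarrow> 'a set) \<Rightarrow> ('i \<times> 'a set) set" where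
  "box_space G I H = (SIGMA i:I. lcosets\<^bsub>G\<^esub> H i)"

definition box_act :: "('a, 'b) monoid_scheme \<Rightarrow> 'a \<Rightarrow> 'i \<times> 'a set \<Rightarrow> 'i \<times> 'a set" where
  "box_act G g x = (fst x, g <#\<^bsub>G\<^esub> snd x)"

definition box_Delta ::
    "('a, 'b) monoid_scheme \<Rightarrow> 'i set \<Rightarrow> ('i \<Rightarrow> 'a set) \<Rightarrow> 'a \<Rightarrow> (('i \<times> 'a set) \<times> ('i \<times> 'a set)) set" where
  "box_Delta G I H g = {(x, box_act G g x) | x. x \<in> box_space G I H}"

text \<open>
  Invariance means that each single group element maps entourages to entourages; it is not
  required that the invariant entourages be cofinal.
\<close>

definition box_invariant ::
    "('a, 'b) monoid_scheme \<Rightarrow> (('i \<times> 'a set) \<times> ('i \<times> 'a set)) set set \<Rightarrow> bool" where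
  "box_invariant G \<E> \<longleftrightarrow>
    (\<forall>g\<in>carrier G. \<forall>E\<in>\<E>. map_prod (box_act G g) (box_act G g) ` E \<in> \<E>)"

definition box_admissible ::
    "('a, 'b) monoid_scheme \<Rightarrow> 'i set \<Rightarrow> ('i \<Rightarrow> 'a set) \<Rightarrow>
     (('i \<times> 'a set) \<times> ('i \<times> 'a set)) set set \<Rightarrow> bool" where
  "box_admissible G I H \<E> \<longleftrightarrow>
    coarse_space (box_space G I H) \<E> \<and> connected_coarse (box_space G I H) \<E>
    \<and> box_invariant G \<E> \<and> (\<forall>g\<in>carrier G. box_Delta G I H g \<in> \<E>)"

definition box_coarse ::
    "('a, 'b) monoid_scheme \<Rightarrow> 'i set \<Rightarrow> ('i \<Rightarrow> 'a set) \<Rightarrow>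
     (('i \<times> 'a set) \<times> ('i \<times> 'a set)) set set" where
  "box_coarse G I H = \<Inter>{\<E>. box_admissible G I H \<E>}"

lemma box_coarse_least: "box_admissible G I H \<E> \<Longrightarrow> box_coarse G I H \<subseteq> \<E>"
  unfolding box_coarse_def by blast

lemma box_act_closed:
  assumes "group G" "\<And>i. i \<in> I \<Longrightarrow> subgroup (H i) G"
    and "g \<in> carrier G" "x \<in> box_space G I H"
  shows "box_act G g x \<in> box_space G I H"
proof -
  interpret group G by fact
  obtain i a where x: "i \<in> I" "a \<in> carrier G" "x = (i, a <#\<^bsub>G\<^esub> H i)"
    using assms(4) unfolding box_space_def LCOSETS_def by blast
  have "g <#\<^bsub>G\<^esub> (a <#\<^bsub>G\<^esub> H i) = (g \<otimes>\<^bsub>G\<^esub> a) <#\<^bsub>G\<^esub> H i"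
    using assms x by (simp add: lcos_m_assoc subgroup.subset)
  then show ?thesis
    using assms(3) x unfolding box_act_def box_space_def LCOSETS_def by auto
qed

lemma box_admissible_Pow:
  assumes "group G" "\<And>i. i \<in> I \<Longrightarrow> subgroup (H i) G"
  shows "box_admissible G I H (Pow (box_space G I H \<times> box_space G I H))"
proof -
  let ?X = "box_space G I H"
  have act: "box_act G g x \<in> ?X" if "g \<in> carrier G" "x \<in> ?X" for g x
    by (rule box_act_closed) (fact assms that)+
  have "coarse_space ?X (Pow (?X \<times> ?X))"
    by unfold_locales blast+
  moreover have "connected_coarse ?X (Pow (?X \<times> ?X))"
    by (simp add: connected_coarse_def)
  moreover have "box_invariant G (Pow (?X \<times> ?X))"
    unfolding box_invariant_def
  proof (intro ballI PowI subsetI)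
    fix g E p
    assume g: "g \<in> carrier G" and E: "E \<in> Pow (?X \<times> ?X)"
      and "p \<in> map_prod (box_act G g) (box_act G g) ` E"
    then obtain x y where "(x, y) \<in> E" "p = (box_act G g x, box_act G g y)"
      by auto
    with E show "p \<in> ?X \<times> ?X"
      unfolding Pow_iff by (auto intro!: act[OF g])
  qed
  moreover have "\<forall>g\<in>carrier G. box_Delta G I H g \<in> Pow (?X \<times> ?X)"
    using act by (auto simp: box_Delta_def)
  ultimately show ?thesis
    by (simp add: box_admissible_def)
qed

lemma box_admissible_box_coarse:
  assumes "group G" "\<And>i. i \<in> I \<Longrightarrow> subgroup (H i) G"
  shows "box_admissible G I H (box_coarse G I H)"
proof -
  let ?X = "box_space G I H" and ?B = "box_coarse G I H"
  have mem: "E \<in> ?B \<longleftrightarrow> (\<forall>\<E>. box_admissible G I H \<E> \<longrightarrow> E \<in> \<E>)" for E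
    unfolding box_coarse_def by blast
  have memD: "E \<in> \<E>" if "E \<in> ?B" "box_admissible G I H \<E>" for E \<E>
    using that mem by blast
  have coarse: "coarse_space ?X \<E>" if "box_admissible G I H \<E>" for \<E>
    using that unfolding box_admissible_def by blast
  have "box_admissible G I H (Pow (?X \<times> ?X))"
    by (rule box_admissible_Pow) (fact assms)+
  note Pow = memD[OF _ this]
  have "coarse_space ?X ?B"
  proof
    show "E \<subseteq> ?X \<times> ?X" if "E \<in> ?B" for E
      using Pow[OF that] by simp
    show "Id_on ?X \<in> ?B"
      unfolding mem by (intro allI impI coarse_space.diagonal coarse)
    show "E' \<in> ?B" if "E \<in> ?B" "E' \<subseteq> E" for E E'
      unfolding mem using coarse_space.subset_closed[OF coarse memD[OF that(1)] that(2)] by blast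
    show "E \<union> E' \<in> ?B" if "E \<in> ?B" "E' \<in> ?B" for E E'
      unfolding mem
      using coarse_space.Un_closed[OF coarse memD[OF that(1)] memD[OF that(2)]] by blast
    show "E\<inverse> \<in> ?B" if "E \<in> ?B" for E
      unfolding mem using coarse_space.converse_closed[OF coarse memD[OF that]] by blast
    show "E O E' \<in> ?B" if "E \<in> ?B" "E' \<in> ?B" for E E'
      unfolding mem
      using coarse_space.relcomp_closed[OF coarse memD[OF that(1)] memD[OF that(2)]] by blast
  qed
  moreover have "connected_coarse ?X ?B"
    unfolding connected_coarse_def mem by (simp add: box_admissible_def connected_coarse_def)
  moreover have "box_invariant G ?B"
    unfolding box_invariant_def
  proof (intro ballI)
    fix g E assume g: "g \<in> carrier G" and E: "E \<in> ?B"
    have "map_prod (box_act G g) (box_act G g) ` E \<in> \<E>" if "box_admissible G I H \<E>" for \<E>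
      using that g memD[OF E that] unfolding box_admissible_def box_invariant_def by simp
    then show "map_prod (box_act G g) (box_act G g) ` E \<in> ?B"
      unfolding mem by simp
  qed
  moreover have "\<forall>g\<in>carrier G. box_Delta G I H g \<in> ?B"
    unfolding mem by (simp add: box_admissible_def)
  ultimately show ?thesis
    by (simp add: box_admissible_def)
qed

definition conj_class :: "('a, 'b) monoid_scheme \<Rightarrow> 'a \<Rightarrow> 'a set" where
  "conj_class G g = {h \<otimes>\<^bsub>G\<^esub> g \<otimes>\<^bsub>G\<^esub> inv\<^bsub>G\<^esub> h | h. h \<in> carrier G}"

definition semi_conjugacy_separating ::
    "('a, 'b) monoid_scheme \<Rightarrow> 'i set \<Rightarrow> ('i \<Rightarrow> 'a set) \<Rightarrow> bool" where
  "semi_conjugacy_separating G I H \<longleftrightarrow>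
    (\<forall>F\<subseteq>carrier G. finite F \<and> F \<noteq> {} \<longrightarrow>
      (\<exists>i\<in>I. \<forall>g\<in>F - {\<one>\<^bsub>G\<^esub>}. H i \<inter> (conj_class G g <#>\<^bsub>G\<^esub> H i) = {}))"

end

theory Submission
  imports Defs
begin

text \<open>
  An entourage of the box space is contained in finitely many of the sets \<open>\<Delta>\<^sub>g\<close> together with
  a square over finitely many components.  Hence a controlled cover of the box space with large
  Lebesgue number restricts, on a component \<open>G/G\<^sub>i\<close> outside these finitely many ones, to a cover by
  sets of diameter at most some \<open>r\<close>.  Semi-conjugacy-separation gives such an \<open>i\<close> for which moreover
  no nontrivial element of length at most \<open>3r\<close> has a fixed point on \<open>G/G\<^sub>i\<close>.  Then \<open>G \<rightarrow> G/G\<^sub>i\<close> is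
  injective at scale \<open>3r\<close>, so the preimage of a member of the cover splits into disjoint sheets of
  diameter at most \<open>r\<close>, and the sheets form the required cover of \<open>G\<close>.  (If \<open>G\<close> is finite there may be
  no such \<open>i\<close>, but then \<open>G\<close> has asymptotic dimension \<open>0\<close>.)
\<close>

lemma coarse_space_UN:
  assumes "coarse_space X \<E>" "finite F" "\<And>g. g \<in> F \<Longrightarrow> D g \<in> \<E>"
  shows "(\<Union>g\<in>F. D g) \<in> \<E>"
  using assms(2,3)
proof (induction F rule: finite_induct)
  case empty
  then show ?case
    using coarse_space.subset_closed[OF assms(1) coarse_space.diagonal[OF assms(1)]] by simp
next
  case (insert g F)
  then show ?case
    by (simp add: coarse_space.Un_closed[OF assms(1)])
qed

lemma asdim_le_mono_asdim:
  assumes "\<And>n. asdim_le Y \<F> n \<Longrightarrow> asdim_le X \<E> n"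
  shows "asdim X \<E> \<le> asdim Y \<F>"
  unfolding asdim_def using assms by (intro INF_superset_mono) auto

lemma asdim_le_finite:
  assumes "Metric_space X d" "finite X"
  shows "asdim_le X (metric_coarse X d) n"
proof -
  obtain R where R: "\<And>x y. x \<in> X \<Longrightarrow> y \<in> X \<Longrightarrow> d x y \<le> R"
  proof
    fix x y assume "x \<in> X" "y \<in> X"
    then show "d x y \<le> Max ((\<lambda>(x, y). d x y) ` (X \<times> X))"
      using assms(2) by (intro Max_ge) force+
  qed
  have "X \<times> X \<in> metric_coarse X d"
    unfolding metric_coarse_def using R by auto
  moreover have "card \<V> \<noteq> n + 2" if "\<V> \<subseteq> {X}" for \<V>
    using card_mono[OF _ that] by simp
  ultimately show ?thesis
    unfolding asdim_le_def by (intro ballI exI[of _ "{X}"]) auto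
qed

context group
begin

lemma finite_if_finite_index_trivial:
  assumes "finite (lcosets {\<one>})"
  shows "finite (carrier G)"
proof -
  have "lcosets {\<one>} = (\<lambda>a. {a}) ` carrier G"
    unfolding LCOSETS_def l_coset_def by auto
  with assms show ?thesis
    by (simp add: finite_image_iff)
qed

lemma box_act_mult:
  assumes "\<And>i. i \<in> I \<Longrightarrow> subgroup (H i) G" "x \<in> box_space G I H"
    and "g \<in> carrier G" "h \<in> carrier G"
  shows "box_act G g (box_act G h x) = box_act G (g \<otimes> h) x"
proof -
  obtain i a where x: "i \<in> I" "a \<in> carrier G" "x = (i, a <# H i)"
    using assms(2) unfolding box_space_def LCOSETS_def by blast
  then have "snd x \<subseteq> carrier G"
    using assms(1) by (simp add: l_coset_subset_G subgroup.subset)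
  with assms(3,4) show ?thesis
    by (simp add: box_act_def lcos_m_assoc)
qed

lemma box_act_one:
  assumes "\<And>i. i \<in> I \<Longrightarrow> subgroup (H i) G" "x \<in> box_space G I H"
  shows "box_act G \<one> x = x"
proof -
  obtain i a where x: "i \<in> I" "a \<in> carrier G" "x = (i, a <# H i)"
    using assms(2) unfolding box_space_def LCOSETS_def by blast
  then have "snd x \<subseteq> carrier G"
    using assms(1) by (simp add: l_coset_subset_G subgroup.subset)
  then show ?thesis
    by (simp add: box_act_def lcos_mult_one)
qed

lemma fst_box_act [simp]: "fst (box_act G g x) = fst x"
  by (simp add: box_act_def)

definition box_basic ::
    "'i set \<Rightarrow> ('i \<Rightarrow> 'a set) \<Rightarrow> 'a set \<Rightarrow> 'i set \<Rightarrow> (('i \<times> 'a set) \<times> ('i \<times> 'a set)) set" where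
  "box_basic I H F J = {(x, y). x \<in> box_space G I H \<and> y \<in> box_space G I H
    \<and> (fst x \<in> J \<and> fst y \<in> J \<or> (\<exists>g\<in>F. y = box_act G g x))}"

lemma box_admissible_basic:
  assumes sub: "\<And>i. i \<in> I \<Longrightarrow> subgroup (H i) G"
  shows "box_admissible G I H
    {E. \<exists>F J. finite F \<and> F \<subseteq> carrier G \<and> finite J \<and> E \<subseteq> box_basic I H F J}"
    (is "box_admissible G I H ?\<E>")
proof -
  let ?X = "box_space G I H"
  have act: "box_act G g x \<in> ?X" if "g \<in> carrier G" "x \<in> ?X" for g x
    by (rule box_act_closed) (fact is_group sub that)+
  note mult = box_act_mult[of I H, OF sub] and one = box_act_one[of I H, OF sub]
  have I: "E \<in> ?\<E>" if "finite F" "F \<subseteq> carrier G" "finite J" "E \<subseteq> box_basic I H F J" for E F J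
    using that by blast
  have "coarse_space ?X ?\<E>"
  proof
    show "E \<subseteq> ?X \<times> ?X" if "E \<in> ?\<E>" for E
      using that unfolding box_basic_def by blast
    have "Id_on ?X \<subseteq> box_basic I H {\<one>} {}"
      unfolding box_basic_def by (auto simp: one)
    then show "Id_on ?X \<in> ?\<E>"
      by (intro I[of "{\<one>}" "{}"]) auto
    show "E' \<in> ?\<E>" if "E \<in> ?\<E>" "E' \<subseteq> E" for E E'
      using that by blast
  next
    fix E assume "E \<in> ?\<E>"
    then obtain F J where E: "finite F" "F \<subseteq> carrier G" "finite J" "E \<subseteq> box_basic I H F J"
      by blast
    have "E\<inverse> \<subseteq> box_basic I H (m_inv G ` F) J"
    proof
      fix p assume "p \<in> E\<inverse>"
      then obtain x y where p: "p = (y, x)" and "(x, y) \<in> E"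
        by blast
      then have xy: "x \<in> ?X" "y \<in> ?X" "fst x \<in> J \<and> fst y \<in> J \<or> (\<exists>g\<in>F. y = box_act G g x)"
        using E(4) unfolding box_basic_def by blast+
      have "x = box_act G (inv g) y" if "g \<in> F" "y = box_act G g x" for g
        using that E(2) xy(1) by (simp add: mult one subsetD)
      with xy p show "p \<in> box_basic I H (m_inv G ` F) J"
        unfolding box_basic_def by blast
    qed
    with E show "E\<inverse> \<in> ?\<E>"
      by (intro I[of "m_inv G ` F" J]) auto
    fix E' assume "E' \<in> ?\<E>"
    then obtain F' J' where E': "finite F'" "F' \<subseteq> carrier G" "finite J'" "E' \<subseteq> box_basic I H F' J'"
      by blast
    have "E \<union> E' \<subseteq> box_basic I H (F \<union> F') (J \<union> J')"
      using E(4) E'(4) unfolding box_basic_def by blast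
    with E E' show "E \<union> E' \<in> ?\<E>"
      by (intro I[of "F \<union> F'" "J \<union> J'"]) auto
    define P where "P = (\<lambda>(g, h). h \<otimes> g) ` (F \<times> F')"
    have P: "finite P" "P \<subseteq> carrier G"
      using E E' unfolding P_def by auto
    have "E O E' \<subseteq> box_basic I H P (J \<union> J')"
    proof
      fix p assume "p \<in> E O E'"
      then obtain x y z where p: "p = (x, z)" and "(x, y) \<in> E" "(y, z) \<in> E'"
        by blast
      then have xy: "x \<in> ?X" "fst x \<in> J \<and> fst y \<in> J \<or> (\<exists>g\<in>F. y = box_act G g x)"
        and yz: "z \<in> ?X" "fst y \<in> J' \<and> fst z \<in> J' \<or> (\<exists>g\<in>F'. z = box_act G g y)"
        using E(4) E'(4) unfolding box_basic_def by blast+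
      have "\<exists>k\<in>P. z = box_act G k x"
        if "g \<in> F" "y = box_act G g x" "h \<in> F'" "z = box_act G h y" for g h
        using that E(2) E'(2) xy(1) unfolding P_def
        by (intro bexI[of _ "h \<otimes> g"]) (auto simp: mult subsetD)
      then have "fst x \<in> J \<union> J' \<and> fst z \<in> J \<union> J' \<or> (\<exists>k\<in>P. z = box_act G k x)"
        using xy(2) yz(2) by auto
      with xy(1) yz(1) p show "p \<in> box_basic I H P (J \<union> J')"
        unfolding box_basic_def by blast
    qed
    with E E' P show "E O E' \<in> ?\<E>"
      by (intro I[of P "J \<union> J'"]) auto
  qed
  moreover have "connected_coarse ?X ?\<E>"
    unfolding connected_coarse_def
  proof (intro ballI)
    fix x y assume "x \<in> ?X" "y \<in> ?X"
    then have "{(x, y)} \<subseteq> box_basic I H {} {fst x, fst y}"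
      unfolding box_basic_def by simp
    then show "{(x, y)} \<in> ?\<E>"
      by (intro I[of "{}" "{fst x, fst y}"]) auto
  qed
  moreover have "box_invariant G ?\<E>"
    unfolding box_invariant_def
  proof (intro ballI)
    fix g E assume g: "g \<in> carrier G" and "E \<in> ?\<E>"
    then obtain F J where E: "finite F" "F \<subseteq> carrier G" "finite J" "E \<subseteq> box_basic I H F J"
      by blast
    let ?C = "(\<lambda>h. g \<otimes> h \<otimes> inv g) ` F"
    have "map_prod (box_act G g) (box_act G g) ` E \<subseteq> box_basic I H ?C J"
    proof
      fix p assume "p \<in> map_prod (box_act G g) (box_act G g) ` E"
      then obtain x y where p: "p = (box_act G g x, box_act G g y)" and "(x, y) \<in> E"
        by auto
      then have xy: "x \<in> ?X" "y \<in> ?X" "fst x \<in> J \<and> fst y \<in> J \<or> (\<exists>h\<in>F. y = box_act G h x)"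
        using E(4) unfolding box_basic_def by blast+
      have "box_act G g y = box_act G (g \<otimes> h \<otimes> inv g) (box_act G g x)"
        if h: "h \<in> F" "y = box_act G h x" for h
      proof -
        have "h \<in> carrier G" using E(2) h(1) by blast
        with g h(2) xy(1) show ?thesis
          by (simp add: mult act m_assoc)
      qed
      then have "fst x \<in> J \<and> fst y \<in> J \<or> (\<exists>k\<in>?C. box_act G g y = box_act G k (box_act G g x))"
        using xy(3) by auto
      then show "p \<in> box_basic I H ?C J"
        unfolding box_basic_def p using act[OF g xy(1)] act[OF g xy(2)] by simp
    qed
    with E g show "map_prod (box_act G g) (box_act G g) ` E \<in> ?\<E>"
      by (intro I[of ?C J]) auto
  qed
  moreover have "\<forall>g\<in>carrier G. box_Delta G I H g \<in> ?\<E>"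
  proof
    fix g assume g: "g \<in> carrier G"
    then have "box_Delta G I H g \<subseteq> box_basic I H {g} {}"
      unfolding box_basic_def box_Delta_def by (auto simp: act)
    with g show "box_Delta G I H g \<in> ?\<E>"
      by (intro I[of "{g}" "{}"]) auto
  qed
  ultimately show ?thesis
    unfolding box_admissible_def by blast
qed

lemma box_coarse_subset_basic:
  assumes "\<And>i. i \<in> I \<Longrightarrow> subgroup (H i) G" "E \<in> box_coarse G I H"
  obtains F J where "finite F" "F \<subseteq> carrier G" "finite J" "E \<subseteq> box_basic I H F J"
  using box_coarse_least[OF box_admissible_basic[of I H, OF assms(1)]] assms(2) by blast

lemma box_coarse_UN_Delta:
  assumes "\<And>i. i \<in> I \<Longrightarrow> subgroup (H i) G" "finite F" "F \<subseteq> carrier G"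
  shows "(\<Union>g\<in>F. box_Delta G I H g) \<in> box_coarse G I H"
  using box_admissible_box_coarse[of G I H, OF is_group assms(1)] assms(2,3)
  unfolding box_admissible_def by (intro coarse_space_UN) auto

lemma fixed_point_conj_class_meets:
  assumes H: "subgroup H G" and g: "g \<in> carrier G" and x: "x \<in> carrier G"
    and fix_pt: "(g \<otimes> x) <# H = x <# H"
  shows "H \<inter> (conj_class G g <#> H) \<noteq> {}"
proof -
  have one: "\<one> \<in> H"
    using H by (rule subgroup.one_closed)
  then have "g \<otimes> x \<in> (g \<otimes> x) <# H"
    unfolding l_coset_def using g x by force
  then obtain h where h: "h \<in> H" "g \<otimes> x = x \<otimes> h"
    unfolding fix_pt unfolding l_coset_def by blast
  have hG: "h \<in> carrier G"
    using H h(1) by (rule subgroup.mem_carrier)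
  have "h = inv x \<otimes> g \<otimes> inv (inv x)"
    using h(2) g x hG by (metis inv_closed inv_inv inv_solve_left m_assoc m_closed)
  then have "h \<in> conj_class G g"
    unfolding conj_class_def using x by blast
  then have "h \<in> conj_class G g <#> H"
    unfolding set_mult_def using one hG by force
  with h(1) show ?thesis by blast
qed

lemma semi_conjugacy_separating_no_fixed_point:
  assumes sub: "\<And>i. i \<in> I \<Longrightarrow> finite_index_subgroup (H i) G"
    and sep: "semi_conjugacy_separating G I H"
    and inf: "infinite (carrier G)"
    and F: "finite F" "F \<subseteq> carrier G" and J: "finite J"
  obtains i where "i \<in> I" "i \<notin> J"
    and "\<And>g x. g \<in> F \<Longrightarrow> x \<in> carrier G \<Longrightarrow> (g \<otimes> x) <# H i = x <# H i \<Longrightarrow> g = \<one>"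
proof -
  have subgrp: "subgroup (H j) G" if "j \<in> I" for j
    using sub[OF that] by (simp add: finite_index_subgroup_def)
  have "\<exists>h. h \<in> H j \<and> h \<noteq> \<one>" if "j \<in> I" for j
  proof (rule ccontr)
    assume "\<not> ?thesis"
    then have "H j = {\<one>}"
      using subgroup.one_closed[OF subgrp[OF that]] by blast
    then have "finite (carrier G)"
      using sub[OF that] finite_if_finite_index_trivial by (simp add: finite_index_subgroup_def)
    with inf show False by simp
  qed
  then obtain h where h: "\<And>j. j \<in> I \<Longrightarrow> h j \<in> H j \<and> h j \<noteq> \<one>"
    by metis
  have hG: "h j \<in> carrier G" if "j \<in> I" for j
    using h[OF that] subgroup.mem_carrier[OF subgrp[OF that]] by blast
  \<comment> \<open>A nontrivial element of \<open>H j\<close> fixes the trivial coset of \<open>H j\<close>, so adding it to \<open>F\<close> excludes \<open>j\<close>.\<close>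
  let ?F = "insert \<one> (F \<union> h ` (J \<inter> I))"
  have "?F \<subseteq> carrier G" "finite ?F" "?F \<noteq> {}"
    using F J hG by auto
  then obtain i where i: "i \<in> I"
    and disj: "\<And>g. g \<in> ?F - {\<one>} \<Longrightarrow> H i \<inter> (conj_class G g <#> H i) = {}"
    using sep unfolding semi_conjugacy_separating_def by meson
  have free: "g = \<one>" if "g \<in> ?F" "x \<in> carrier G" "(g \<otimes> x) <# H i = x <# H i" for g x
    using disj[of g] fixed_point_conj_class_meets[OF subgrp[OF i] _ that(2,3)] that(1)
      \<open>?F \<subseteq> carrier G\<close> by blast
  have "i \<notin> J"
  proof
    assume "i \<in> J"
    have "(h i \<otimes> \<one>) <# H i = \<one> <# H i"
      using h[OF i] hG[OF i] subgrp[OF i]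
      by (metis coset_join3 lcos_mult_one r_one subgroup.subset)
    with \<open>i \<in> J\<close> i free[of "h i" \<one>] h[OF i] show False by auto
  qed
  with i free show ?thesis by (intro that[of i]) auto
qed

end

lemma asdim_le_group_if_asdim_le_box_space:
  fixes G :: "('a, 'b) monoid_scheme" (structure)
  assumes "group G"
    and proper: "proper_metric (carrier G) d"
    and rinv: "right_invariant G d"
    and sub: "\<And>i. i \<in> I \<Longrightarrow> finite_index_subgroup (H i) G"
    and sep: "semi_conjugacy_separating G I H"
    and inf: "infinite (carrier G)"
    and box: "asdim_le (box_space G I H) (box_coarse G I H) n"
  shows "asdim_le (carrier G) (metric_coarse (carrier G) d) n"
  unfolding asdim_le_def
proof
  interpret group G by fact
  interpret M: Metric_space "carrier G" d
    using proper by (simp add: proper_metric_def)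
  have subgrp: "subgroup (H i) G" if "i \<in> I" for i
    using sub[OF that] by (simp add: finite_index_subgroup_def)
  define B where "B r = {g \<in> carrier G. d \<one> g \<le> r}" for r
  have BG: "B r \<subseteq> carrier G" for r
    unfolding B_def by blast
  have finB: "finite (B r)" for r
  proof -
    have "B r = M.mcball \<one> r"
      unfolding B_def M.mcball_def by auto
    with proper show ?thesis by (simp add: proper_metric_def)
  qed
  have d_quot: "d \<one> (y \<otimes> inv x) = d x y" if "x \<in> carrier G" "y \<in> carrier G" for x y
  proof -
    have "d (x \<otimes> inv x) (y \<otimes> inv x) = d x y"
      using rinv that unfolding right_invariant_def by blast
    with that show ?thesis by simp
  qed
  fix E assume "E \<in> metric_coarse (carrier G) d"
  then obtain R where R: "\<And>x y. (x, y) \<in> E \<Longrightarrow> d x y \<le> R"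
    unfolding metric_coarse_def by blast
  define D where "D = (\<Union>g\<in>B R. box_Delta G I H g)"
  have D: "D \<in> box_coarse G I H"
    unfolding D_def using box_coarse_UN_Delta[of I H "B R", OF subgrp] finB BG by blast
  obtain \<U> where \<U>_ent: "(\<Union>U\<in>\<U>. U \<times> U) \<in> box_coarse G I H"
    and \<U>_cover: "\<Union>\<U> = box_space G I H"
    and \<U>_mult: "\<forall>\<V>\<subseteq>\<U>. card \<V> = n + 2 \<longrightarrow> \<Inter>\<V> = {}"
    and \<U>_leb: "\<forall>A\<subseteq>box_space G I H. A \<noteq> {} \<and> A \<times> A \<subseteq> D \<longrightarrow> (\<exists>U\<in>\<U>. A \<subseteq> U)"
    using bspec[OF box[unfolded asdim_le_def] D] by (elim exE conjE) (rule that; assumption)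
  obtain F J where F: "finite F" "F \<subseteq> carrier G" and J: "finite J"
    and FJ: "(\<Union>U\<in>\<U>. U \<times> U) \<subseteq> box_basic I H F J"
    using box_coarse_subset_basic[of I H, OF subgrp \<U>_ent] by blast
  define r where "r = Max (insert 0 (insert R (d \<one> ` F)))"
  have r: "0 \<le> r" "R \<le> r" "\<And>g. g \<in> F \<Longrightarrow> d \<one> g \<le> r"
    unfolding r_def by (rule Max_ge; simp add: F(1))+
  obtain i where i: "i \<in> I" "i \<notin> J"
    and free: "\<And>g x. g \<in> B (3 * r) \<Longrightarrow> x \<in> carrier G \<Longrightarrow> (g \<otimes> x) <# H i = x <# H i \<Longrightarrow> g = \<one>"
    using semi_conjugacy_separating_no_fixed_point[of I H "B (3 * r)" J, OF sub sep inf finB BG J]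
    by blast
  define \<pi> where "\<pi> x = (i, x <# H i)" for x
  have \<pi>_box: "\<pi> x \<in> box_space G I H" if "x \<in> carrier G" for x
    using that i(1) unfolding \<pi>_def box_space_def LCOSETS_def by blast
  have \<pi>_mult: "box_act G g (\<pi> x) = \<pi> (g \<otimes> x)" if "g \<in> carrier G" "x \<in> carrier G" for g x
    using that subgroup.subset[OF subgrp[OF i(1)]]
    by (simp add: \<pi>_def box_act_def lcos_m_assoc)
  have \<pi>_inj: "x = y" if "x \<in> carrier G" "y \<in> carrier G" "\<pi> x = \<pi> y" "d x y \<le> 3 * r" for x y
  proof -
    have "y \<otimes> inv x \<in> B (3 * r)"
      unfolding B_def using that d_quot by simp
    moreover have "((y \<otimes> inv x) \<otimes> x) <# H i = x <# H i"
      using that by (simp add: \<pi>_def m_assoc)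
    ultimately have "y \<otimes> inv x = \<one>"
      using free that(1) by blast
    with that(1,2) show ?thesis
      by (metis inv_closed inv_equality inv_inv)
  qed
  have gap: "d y z \<le> r"
    if U: "U \<in> \<U>" "\<pi> y \<in> U" "\<pi> z \<in> U" and yz: "y \<in> carrier G" "z \<in> carrier G" "d y z \<le> 2 * r"
    for U y z
  proof -
    have "(\<pi> y, \<pi> z) \<in> box_basic I H F J"
      using U FJ by blast
    then obtain g where g: "g \<in> F" "\<pi> z = box_act G g (\<pi> y)"
      using i(2) unfolding box_basic_def \<pi>_def by auto
    have gG: "g \<in> carrier G" using g(1) F(2) by blast
    have close: "d y (g \<otimes> y) \<le> r"
      using d_quot[of y "g \<otimes> y"] r(3)[OF g(1)] gG yz(1) by (simp add: m_assoc)
    moreover have "d z (g \<otimes> y) \<le> d y z + d y (g \<otimes> y)"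
      using M.triangle[of z y "g \<otimes> y"] M.commute[of y z] gG yz by simp
    ultimately have "d z (g \<otimes> y) \<le> 3 * r"
      using yz(3) by linarith
    then have "z = g \<otimes> y"
      using \<pi>_inj[of z "g \<otimes> y"] g(2) gG yz \<pi>_mult by simp
    with close show ?thesis by simp
  qed
  define sheet where "sheet U y = {z \<in> carrier G. \<pi> z \<in> U \<and> d y z \<le> r}" for U y
  have sheet_subset: "sheet U y \<subseteq> sheet U z"
    if U: "U \<in> \<U>" and yz: "y \<in> carrier G" "z \<in> carrier G" "\<pi> z \<in> U" "d y z \<le> r" for U y z
  proof
    fix w assume "w \<in> sheet U y"
    then have w: "w \<in> carrier G" "\<pi> w \<in> U" "d y w \<le> r"
      unfolding sheet_def by auto
    have "d z w \<le> 2 * r"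
      using M.triangle[of z y w] M.commute[of y z] w yz by simp
    with gap[OF U yz(3) w(2) yz(2) w(1)] w show "w \<in> sheet U z"
      unfolding sheet_def by blast
  qed
  have sheet_eq: "sheet U y = sheet U z"
    if "U \<in> \<U>" "y \<in> carrier G" "\<pi> y \<in> U" "z \<in> sheet U y" for U y z
  proof
    have z: "z \<in> carrier G" "\<pi> z \<in> U" "d y z \<le> r"
      using that(4) unfolding sheet_def by auto
    show "sheet U y \<subseteq> sheet U z"
      using that z by (intro sheet_subset)
    show "sheet U z \<subseteq> sheet U y"
      using that z M.commute[of y z] by (intro sheet_subset) auto
  qed
  define \<W> where "\<W> = {sheet U y | U y. U \<in> \<U> \<and> y \<in> carrier G \<and> \<pi> y \<in> U}"
  have \<W>_eq: "\<exists>U\<in>\<U>. \<pi> z \<in> U \<and> W = sheet U z" if "W \<in> \<W>" "z \<in> W" for W z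
  proof -
    obtain U y where U: "U \<in> \<U>" "y \<in> carrier G" "\<pi> y \<in> U" "W = sheet U y"
      using \<open>W \<in> \<W>\<close> unfolding \<W>_def by blast
    with that(2) sheet_eq[OF U(1-3)] show ?thesis
      unfolding sheet_def by blast
  qed
  have self: "y \<in> sheet U y" if "y \<in> carrier G" "\<pi> y \<in> U" for U y
    using that r(1) unfolding sheet_def by simp
  have \<W>_Pow: "\<W> \<subseteq> Pow (carrier G)"
    unfolding \<W>_def sheet_def by blast
  have \<W>_cover: "\<Union>\<W> = carrier G"
  proof
    show "\<Union>\<W> \<subseteq> carrier G"
      using \<W>_Pow by blast
    show "carrier G \<subseteq> \<Union>\<W>"
    proof
      fix y assume y: "y \<in> carrier G"
      obtain U where "U \<in> \<U>" "\<pi> y \<in> U"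
        using \<pi>_box[OF y] \<U>_cover by blast
      with y self show "y \<in> \<Union>\<W>"
        unfolding \<W>_def by blast
    qed
  qed
  have \<W>_ent: "(\<Union>W\<in>\<W>. W \<times> W) \<in> metric_coarse (carrier G) d"
  proof -
    have "(\<Union>W\<in>\<W>. W \<times> W) \<subseteq> {(x, y). x \<in> carrier G \<and> y \<in> carrier G \<and> d x y \<le> r}"
    proof clarify
      fix W x y assume W: "W \<in> \<W>" "x \<in> W" "y \<in> W"
      then have "x \<in> carrier G"
        using \<W>_Pow by blast
      with W \<W>_eq[OF W(1,2)] show "x \<in> carrier G \<and> y \<in> carrier G \<and> d x y \<le> r"
        unfolding sheet_def by blast
    qed
    then show ?thesis
      unfolding metric_coarse_def by blast
  qed
  have \<W>_mult: "\<Inter>\<V> = {}" if \<V>: "\<V> \<subseteq> \<W>" "card \<V> = n + 2" for \<V>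
  proof (rule ccontr)
    assume "\<Inter>\<V> \<noteq> {}"
    then obtain z where z: "\<And>W. W \<in> \<V> \<Longrightarrow> z \<in> W"
      by blast
    then have "\<exists>U\<in>\<U>. \<pi> z \<in> U \<and> W = sheet U z" if "W \<in> \<V>" for W
      using that \<V>(1) \<W>_eq by blast
    then obtain u where u: "\<And>W. W \<in> \<V> \<Longrightarrow> u W \<in> \<U> \<and> \<pi> z \<in> u W \<and> W = sheet (u W) z"
      by metis
    have "inj_on u \<V>"
      using u by (metis inj_onI)
    then have "card (u ` \<V>) = n + 2"
      using \<V>(2) by (simp add: card_image)
    moreover have "u ` \<V> \<subseteq> \<U>"
      using u by blast
    ultimately have "\<Inter>(u ` \<V>) = {}"
      using \<U>_mult by blast
    with u show False by blast
  qed
  have \<W>_leb: "\<exists>W\<in>\<W>. A \<subseteq> W" if A: "A \<subseteq> carrier G" "A \<noteq> {}" "A \<times> A \<subseteq> E" for A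
  proof -
    have "(\<pi> x, \<pi> y) \<in> D" if "x \<in> A" "y \<in> A" for x y
    proof -
      from that have G: "x \<in> carrier G" "y \<in> carrier G" and "d x y \<le> R"
        using A R by blast+
      then have "y \<otimes> inv x \<in> B R"
        unfolding B_def using d_quot by simp
      moreover have "\<pi> y = box_act G (y \<otimes> inv x) (\<pi> x)"
        using G by (simp add: \<pi>_mult m_assoc)
      then have "(\<pi> x, \<pi> y) \<in> box_Delta G I H (y \<otimes> inv x)"
        unfolding box_Delta_def using \<pi>_box[OF G(1)] by blast
      ultimately show ?thesis
        unfolding D_def by blast
    qed
    then have "\<pi> ` A \<times> \<pi> ` A \<subseteq> D"
      by auto
    moreover have "\<pi> ` A \<subseteq> box_space G I H"
      using A(1) \<pi>_box by blast
    ultimately obtain U where U: "U \<in> \<U>" "\<pi> ` A \<subseteq> U"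
      using \<U>_leb[rule_format, of "\<pi> ` A"] A(2) by blast
    obtain a where a: "a \<in> A"
      using A(2) by blast
    have "d a x \<le> r" if "x \<in> A" for x
      using R[of a x] a that A(3) r(2) by fastforce
    then have "A \<subseteq> sheet U a"
      unfolding sheet_def using A(1) U(2) by blast
    moreover have "sheet U a \<in> \<W>"
      unfolding \<W>_def using U a A(1) by blast
    ultimately show ?thesis by blast
  qed
  show "\<exists>\<U>\<subseteq>Pow (carrier G). \<Union>\<U> = carrier G
      \<and> (\<Union>U\<in>\<U>. U \<times> U) \<in> metric_coarse (carrier G) d
      \<and> (\<forall>\<V>\<subseteq>\<U>. card \<V> = n + 2 \<longrightarrow> \<Inter>\<V> = {})
      \<and> (\<forall>A\<subseteq>carrier G. A \<noteq> {} \<and> A \<times> A \<subseteq> E \<longrightarrow> (\<exists>U\<in>\<U>. A \<subseteq> U))"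
    using \<W>_Pow \<W>_cover \<W>_ent
    by (intro exI[of _ \<W>] conjI allI impI)
      (assumption, assumption, assumption, (rule \<W>_mult; assumption),
        elim conjE, (rule \<W>_leb; assumption))
qed

theorem proposition3p16:
  fixes G :: "('a, 'b) monoid_scheme"
    and d :: "'a \<Rightarrow> 'a \<Rightarrow> real"
    and I :: "'i set"
    and H :: "'i \<Rightarrow> 'a set"
  assumes "group G"
    and "countable (carrier G)"
    and "residually_finite G"
    and "proper_metric (carrier G) d"
    and "right_invariant G d"
    and "\<And>i. i \<in> I \<Longrightarrow> finite_index_subgroup (H i) G"
    and "semi_conjugacy_separating G I H"
  shows "asdim (carrier G) (metric_coarse (carrier G) d)
           \<le> asdim (box_space G I H) (box_coarse G I H)"
proof (rule asdim_le_mono_asdim)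
  fix n assume n: "asdim_le (box_space G I H) (box_coarse G I H) n"
  show "asdim_le (carrier G) (metric_coarse (carrier G) d) n"
  proof (cases "finite (carrier G)")
    case True
    then show ?thesis
      using assms(4) by (simp add: asdim_le_finite proper_metric_def)
  next
    case False
    then show ?thesis
      using asdim_le_group_if_asdim_le_box_space[of G d I H n] assms n by blast
  qed
qed

end
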